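(* Let $(X,\tau)$ be a Hausdorff topological space, $k$ a positive integer, and $\Phi:X\to\mathbf R$, $\Psi:X\to\,]-\infty,+\infty]$ two functions. Assume that there is a real number $r>\inf_X\Psi$ such that the set $\overline{\Psi^{-1}(]-\infty,r[)}$ is compact and first-countable. Moreover, suppose that $\Phi$ is bounded below in $\overline{\Psi^{-1}(]-\infty,r[)}$ and that the function $\Psi+\lambda\Phi$ is sequentially lower semicontinuous for each $\lambda\ge 0$ small enough. Finally, assume that the set of all global minima of $\Psi$ has at least $k$ connected components. Then there exists $\lambda^*>0$ such that, for each $\lambda\in\,]0,\lambda^*[$, the function $\Psi+\lambda\Phi$ has at least $k$ $\tau_\Psi$-local minima lying in $\Psi^{-1}(]-\infty,r[)$.
   Context: Closure, compactness, first-countability (of a subset, in its subspace topology), connectedness and sequential lower semicontinuity are with respect to $\tau$. The set of all global minima of $\Psi$ is $\{x\in X:\Psi(x)=\inf_X\Psi\}$. For $\Psi:X\to\,]-\infty,+\infty]$ not identically $+\infty$, $\tau_\Psi$ denotes the smallest topology on $X$ containing both $\tau$ and the family of sets $\{\Psi^{-1}(]-\infty,s[)\}_{s\in\mathbf R}$. A $\tau_\Psi$-local minimum of a function $F$ on $X$ is a point $x\in X$ such that $F(x)\le F(y)$ for all $y$ in some $\tau_\Psi$-neighbourhood of $x$. "For each $\lambda\ge0$ small enough" means: there is $\lambda'>0$ such that the property holds for all $\lambda\in[0,\lambda']$. *)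

theory Defs
  imports "HOL-Analysis.Analysis"
begin

definition seq_lsc :: "'a topology \<Rightarrow> ('a \<Rightarrow> ereal) \<Rightarrow> bool" where
  "seq_lsc T F \<longleftrightarrow>
     (\<forall>\<sigma> l. range \<sigma> \<subseteq> topspace T \<longrightarrow> limitin T \<sigma> l sequentially \<longrightarrow>
        F l \<le> liminf (\<lambda>n. F (\<sigma> n)))"

definition strict_sublevel :: "'a topology \<Rightarrow> ('a \<Rightarrow> ereal) \<Rightarrow> real \<Rightarrow> 'a set" where
  "strict_sublevel T F s = {x \<in> topspace T. F x < ereal s}"

definition global_minima :: "'a topology \<Rightarrow> ('a \<Rightarrow> ereal) \<Rightarrow> 'a set" where
  "global_minima T F = {x \<in> topspace T. F x = (INF y \<in> topspace T. F y)}"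

definition sublevel_topology :: "'a topology \<Rightarrow> ('a \<Rightarrow> ereal) \<Rightarrow> 'a topology" where
  "sublevel_topology T F =
     topology_generated_by ({U. openin T U} \<union> range (strict_sublevel T F))"

definition is_local_min :: "'a topology \<Rightarrow> ('a \<Rightarrow> ereal) \<Rightarrow> 'a \<Rightarrow> bool" where
  "is_local_min T F x \<longleftrightarrow>
     x \<in> topspace T \<and> (\<exists>U. openin T U \<and> x \<in> U \<and> (\<forall>y\<in>U. F x \<le> F y))"

text \<open>Meaningful for infinite sets as well, whose \<^const>\<open>card\<close> is zero.\<close>

definition has_at_least :: "nat \<Rightarrow> 'a set \<Rightarrow> bool" where
  "has_at_least k A \<longleftrightarrow> (\<exists>B \<subseteq> A. finite B \<and> card B = k)"

lemma topspace_sublevel_topology: "topspace (sublevel_topology T F) = topspace T"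
  unfolding sublevel_topology_def topology_generated_by_topspace strict_sublevel_def
  by (auto dest: openin_subset)

lemma openin_sublevel_topology_base: "openin T U \<Longrightarrow> openin (sublevel_topology T F) U"
  unfolding sublevel_topology_def by (rule topology_generated_by_Basis) simp

lemma openin_sublevel_topology_sublevel:
  "openin (sublevel_topology T F) (strict_sublevel T F s)"
  unfolding sublevel_topology_def by (rule topology_generated_by_Basis) simp

lemma sublevel_topology_smallest:
  assumes "\<And>U. openin T U \<Longrightarrow> openin T' U"
    and "\<And>s. openin T' (strict_sublevel T F s)"
    and "openin (sublevel_topology T F) V"
  shows "openin T' V"
proof -
  have "generate_topology_on ({U. openin T U} \<union> range (strict_sublevel T F)) V"
    using assms(3) unfolding sublevel_topology_def by (simp add: openin_topology_generated_by)
  then show ?thesis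
    by (rule generate_topology_on_coarsest[OF istopology_openin, rotated])
      (use assms(1,2) in auto)
qed

end

theory Submission
  imports Defs
begin

text \<open>
  Near the bottom of \<open>\<Psi>\<close> the sublevel sets split along the components of the set of minima,
  and a small multiple of \<open>\<Phi>\<close> cannot push a minimizer from one piece of such a sublevel set
  up to its rim.

  Write \<open>C\<close> for the closure of \<open>{\<Psi> < r}\<close>, \<open>m = inf \<Psi>\<close> and \<open>M = {\<Psi> = m} \<subseteq> C\<close>.  As \<open>C\<close> is
  first-countable, sequential lower semicontinuity makes \<open>\<Psi> + \<mu> \<Phi>\<close> lower semicontinuous on \<open>C\<close>
  (lemma \<open>closedin_sublevel_seq_lsc\<close>), so it attains its infimum on compact subsets of \<open>C\<close>.  In
  particular \<open>M\<close> is compact, hence its components are its quasi-components, and \<open>k\<close> of them lie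
  in pairwise disjoint clopen parts \<open>D\<close> of \<open>M\<close>, with pairwise disjoint neighbourhoods \<open>G\<close> in the
  whole space (lemma \<open>disjoint_neighbourhoods_of_components\<close>).

  Each part \<open>D\<close> produces one local minimum in \<open>G\<close> (lemma \<open>local_min_near_clopen_part\<close>): if \<open>V\<close>
  and \<open>W\<close> are disjoint open neighbourhoods of \<open>D\<close> and \<open>M - D\<close>, with \<open>V \<subseteq> G\<close>, then \<open>\<Psi>\<close> is bounded
  away from \<open>m\<close> on the compact set \<open>C - (V \<union> W)\<close>, so for some \<open>s\<close> between \<open>m\<close> and \<open>r\<close> the set
  \<open>{\<Psi> \<le> s}\<close> lies in \<open>V \<union> W\<close>.  Its part in \<open>V\<close> is compact, and there \<open>\<Psi> + \<mu> \<Phi>\<close> has a minimizer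
  \<open>x\<close>.  Comparing \<open>x\<close> with a point \<open>z\<close> of \<open>D\<close>, where \<open>\<Psi> z = m\<close>, gives
  \<open>\<Psi> x \<le> m + \<mu> (\<Phi> z - inf\<^sub>C \<Phi>) < s\<close> for small \<open>\<mu>\<close>; hence \<open>V \<inter> {\<Psi> < s}\<close> is a neighbourhood of
  \<open>x\<close> in the topology refined by the sublevel sets of \<open>\<Psi>\<close>, and \<open>x\<close> is a minimizer on it.  The
  \<open>k\<close> points so obtained are distinct because the sets \<open>G\<close> are disjoint.
\<close>

section \<open>Sequential lower semicontinuity and attained infima\<close>

text \<open>From each intersection of finitely many members of a countable base at \<open>x\<close> a point of \<open>S\<close> is
  chosen; as these intersections shrink into every neighbourhood of \<open>x\<close>, the points converge.\<close>

lemma first_countable_closure_of_imp_limitin: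
  assumes "first_countable X" and x: "x \<in> X closure_of S"
  obtains \<sigma> where "range \<sigma> \<subseteq> S \<inter> topspace X" "limitin X \<sigma> x sequentially"
proof -
  have xX: "x \<in> topspace X"
    using x by (simp add: in_closure_of)
  then obtain \<B> where "countable \<B>" and op: "\<And>V. V \<in> \<B> \<Longrightarrow> openin X V"
    and base: "\<And>U. openin X U \<Longrightarrow> x \<in> U \<Longrightarrow> \<exists>V\<in>\<B>. x \<in> V \<and> V \<subseteq> U"
    using assms(1) unfolding first_countable_def by meson
  define \<A> where "\<A> = {V \<in> \<B>. x \<in> V}"
  define e where "e = from_nat_into \<A>"
  have "\<A> \<noteq> {}" and cA: "countable \<A>"
    using base[OF openin_topspace xX] \<open>countable \<B>\<close> by (auto simp: \<A>_def)
  then have e: "openin X (e n)" "x \<in> e n" for n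
    using from_nat_into[of \<A> n] op by (auto simp: e_def \<A>_def)
  have "\<exists>y \<in> S \<inter> topspace X. y \<in> (\<Inter>i\<le>n. e i)" for n :: nat
  proof -
    have "openin X (\<Inter>i\<le>n. e i)"
      using e by (intro openin_INT2) auto
    moreover have "x \<in> (\<Inter>i\<le>n. e i)"
      using e by auto
    ultimately obtain y where "y \<in> S" "y \<in> (\<Inter>i\<le>n. e i)"
      using x unfolding in_closure_of by blast
    moreover have "y \<in> topspace X"
      using calculation(2) openin_subset[OF e(1)[of n]] by auto
    ultimately show ?thesis
      by blast
  qed
  then obtain \<sigma> where \<sigma>: "\<And>n. \<sigma> n \<in> S \<inter> topspace X" "\<And>n. \<sigma> n \<in> (\<Inter>i\<le>n. e i)"
    by metis
  have "\<exists>N. \<forall>n\<ge>N. \<sigma> n \<in> U" if U: "openin X U" "x \<in> U" for U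
  proof -
    obtain V where "V \<in> \<A>" "V \<subseteq> U"
      using base[OF U] by (auto simp: \<A>_def)
    then obtain i where "e i \<subseteq> U"
      using from_nat_into_surj[OF cA] by (metis e_def)
    then show ?thesis
      using \<sigma>(2) by (intro exI[of _ i]) auto
  qed
  then have "limitin X \<sigma> x sequentially"
    using xX by (simp add: limitin_sequentially)
  with \<sigma>(1) show ?thesis
    using that by blast
qed

text \<open>A point of \<open>C\<close> in the closure of the sublevel set is the limit of a sequence in that set,
  because \<open>C\<close> is first-countable; along the sequence \<open>F\<close> stays below \<open>t\<close>, hence so does its limit
  inferior, which bounds \<open>F\<close> at the limit.\<close>

lemma closedin_sublevel_seq_lsc:
  assumes lsc: "seq_lsc T F" and C: "closedin T C" and fc: "first_countable (subtopology T C)"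
  shows "closedin T {x \<in> C. F x \<le> t}"
proof -
  have CT: "C \<subseteq> topspace T"
    using C by (rule closedin_subset)
  let ?S = "{x \<in> C. F x \<le> t}"
  have "subtopology T C closure_of ?S \<subseteq> ?S"
  proof
    fix x assume x: "x \<in> subtopology T C closure_of ?S"
    obtain \<sigma> where \<sigma>: "range \<sigma> \<subseteq> ?S \<inter> topspace (subtopology T C)"
      and lim: "limitin (subtopology T C) \<sigma> x sequentially"
      by (rule first_countable_closure_of_imp_limitin[OF fc x])
    have "x \<in> C" and "limitin T \<sigma> x sequentially"
      using lim by (auto simp: limitin_subtopology)
    moreover have "range \<sigma> \<subseteq> topspace T"
      using \<sigma> CT by blast
    ultimately have "F x \<le> liminf (\<lambda>n. F (\<sigma> n))"
      using lsc unfolding seq_lsc_def by blast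
    also have "\<dots> \<le> t"
      using \<sigma> by (intro Liminf_le always_eventually) auto
    finally show "x \<in> ?S"
      using \<open>x \<in> C\<close> by simp
  qed
  then have "closedin (subtopology T C) ?S"
    using CT by (subst closure_of_subset_eq[symmetric]) auto
  with C show ?thesis
    by (rule closedin_trans_full[rotated])
qed

lemma compactin_attains_inf_closed_sublevels:
  fixes F :: "'a \<Rightarrow> 'b::linorder"
  assumes A: "compactin T A" "A \<noteq> {}" and cl: "\<And>t. closedin T {x \<in> A. F x \<le> t}"
  obtains a where "a \<in> A" "\<And>y. y \<in> A \<Longrightarrow> F a \<le> F y"
proof -
  let ?U = "\<lambda>y. topspace T - {x \<in> A. F x \<le> F y}"
  have "\<exists>a\<in>A. \<forall>y\<in>A. F a \<le> F y"
  proof (rule ccontr)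
    \<comment> \<open>Without a minimizer the complements of the sublevel sets cover the compact set, but the
      lowest of the finitely many centres of a subcover is missed.\<close>
    assume no: "\<not> ?thesis"
    have "\<exists>\<F>. finite \<F> \<and> \<F> \<subseteq> ?U ` A \<and> A \<subseteq> \<Union>\<F>"
    proof -
      have "A \<subseteq> \<Union>(?U ` A)"
        using no compactin_subset_topspace[OF A(1)] by (fastforce simp: not_le)
      moreover have "\<forall>U \<in> ?U ` A. openin T U"
        using cl by blast
      ultimately show ?thesis
        using A(1) unfolding compactin_def by blast
    qed
    then obtain Y where Y: "Y \<subseteq> A" "finite Y" "A \<subseteq> \<Union>(?U ` Y)"
      by (force dest: finite_subset_image)
    then have "Y \<noteq> {}"
      using A(2) by auto
    then obtain y0 where y0: "y0 \<in> Y" "\<And>y. y \<in> Y \<Longrightarrow> F y0 \<le> F y"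
      using Y(2) arg_min_least[of Y _ F] arg_min_if_finite(1)[of Y F] by blast
    with Y(1,3) show False
      by blast
  qed
  then show ?thesis
    using that by blast
qed

section \<open>Separating components of a compact set\<close>

text \<open>For two components \<open>c\<close> and \<open>d\<close> a clopen set \<open>E c d\<close> contains the first and misses the second.
  Intersecting the sets \<open>E c d - E d c\<close> over all \<open>d\<close> gives parts that are disjoint for reasons of
  symmetry, so no exhaustion of the compact set by the parts has to be arranged; the
  corresponding intersections of separating open sets give their neighbourhoods.\<close>

lemma disjoint_neighbourhoods_of_components:
  assumes T: "Hausdorff_space T" and M: "compactin T M"
    and B: "B \<subseteq> connected_components_of (subtopology T M)" "finite B"
  obtains D G where
    "\<And>c. c \<in> B \<Longrightarrow> D c \<noteq> {}" "\<And>c. c \<in> B \<Longrightarrow> D c \<subseteq> M"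
    "\<And>c. c \<in> B \<Longrightarrow> compactin T (D c)" "\<And>c. c \<in> B \<Longrightarrow> compactin T (M - D c)"
    "\<And>c. c \<in> B \<Longrightarrow> openin T (G c)" "\<And>c. c \<in> B \<Longrightarrow> D c \<subseteq> G c" "disjoint_family_on G B"
proof -
  let ?M = "subtopology T M"
  have MT: "M \<subseteq> topspace T"
    using M by (rule compactin_subset_topspace)
  then have tM: "topspace ?M = M"
    by auto
  have cM: "compact_space ?M" and hM: "Hausdorff_space ?M"
    using M T by (simp_all add: compact_space_subtopology Hausdorff_space_subtopology)
  have compact_closed: "compactin T S" if "closedin ?M S" for S
    using closedin_compact_space[OF cM that] by (simp add: compactin_subtopology)
  have quasi: "quasi_components_of ?M = connected_components_of ?M"
    using cM hM by (intro quasi_eq_connected_components_of) simp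
  have "\<exists>E P Q. openin ?M E \<and> closedin ?M E \<and> c \<subseteq> E \<and> d \<inter> E = {} \<and>
      openin T P \<and> openin T Q \<and> E \<subseteq> P \<and> M - E \<subseteq> Q \<and> P \<inter> Q = {}"
    if cd: "c \<in> B" "d \<in> B" "c \<noteq> d" for c d
  proof -
    have "disjnt c d"
      using cd B(1) pairwise_disjoint_connected_components_of[of ?M]
      by (auto simp: pairwise_def)
    then have "separated_between ?M c d"
      using separated_between_quasi_components[of c ?M d] quasi cd B(1) by auto
    then obtain E E' where E: "openin ?M E" "openin ?M E'" "E \<union> E' = M" "disjnt E E'"
        "c \<subseteq> E" "d \<subseteq> E'"
      unfolding separated_between_def tM by blast
    then have E': "E' = M - E"
      by (auto simp: disjnt_def)
    have "closedin ?M E" "closedin ?M (M - E)"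
      using E E' openin_subset[OF E(1)] tM
      by (auto simp: closedin_def double_diff)
    then obtain P Q where "openin T P" "openin T Q" "E \<subseteq> P" "M - E \<subseteq> Q" "disjnt P Q"
      using Hausdorff_space_compact_separation[OF T, of E "M - E"] compact_closed
      by (metis Diff_disjoint disjnt_def)
    with E E' \<open>closedin ?M E\<close> show ?thesis
      by (intro exI[of _ E] exI[of _ P] exI[of _ Q]) (auto simp: disjnt_def)
  qed
  then obtain E P Q where E: "\<And>c d. c \<in> B \<Longrightarrow> d \<in> B \<Longrightarrow> c \<noteq> d \<Longrightarrow>
      openin ?M (E c d) \<and> closedin ?M (E c d) \<and> c \<subseteq> E c d \<and> d \<inter> E c d = {} \<and>
      openin T (P c d) \<and> openin T (Q c d) \<and> E c d \<subseteq> P c d \<and> M - E c d \<subseteq> Q c d \<and>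
      P c d \<inter> Q c d = {}"
    by metis
  define D where "D c = M \<inter> (\<Inter>d\<in>B - {c}. E c d - E d c)" for c
  define G where "G c = (\<Inter>d\<in>B - {c}. P c d \<inter> Q d c) \<inter> topspace T" for c
  have DM: "D c \<subseteq> M" for c
    by (auto simp: D_def)
  have clopen: "openin ?M (D c) \<and> closedin ?M (D c)" if "c \<in> B" for c
  proof -
    let ?\<K> = "insert (topspace ?M) ((\<lambda>d. E c d - E d c) ` (B - {c}))"
    have "openin ?M (E c d - E d c)" "closedin ?M (E c d - E d c)" if "d \<in> B - {c}" for d
      using E[of c d] E[of d c] that \<open>c \<in> B\<close> by (blast intro: openin_diff closedin_diff)+
    then have "openin ?M K" "closedin ?M K" if "K \<in> ?\<K>" for K
      using that by (auto simp del: topspace_subtopology)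
    then have "openin ?M (\<Inter>?\<K>)" "closedin ?M (\<Inter>?\<K>)"
      using B(2) by (blast intro: openin_Inter closedin_Inter)+
    moreover have "D c = \<Inter>?\<K>"
      unfolding D_def tM by blast
    ultimately show ?thesis
      by simp
  qed
  show ?thesis
  proof
    fix c assume c: "c \<in> B"
    have "c \<noteq> {}" "c \<subseteq> M"
      using c B(1) nonempty_connected_components_of connected_components_of_subset tM by blast+
    moreover have "c \<subseteq> E c d - E d c" if "d \<in> B - {c}" for d
      using E[of c d] E[of d c] that c by blast
    ultimately show "D c \<noteq> {}"
      unfolding D_def by blast
    show "D c \<subseteq> M"
      by (rule DM)
    show "compactin T (D c)"
      using clopen[OF c] compact_closed by blast
    have "closedin ?M (M - D c)"
      using clopen[OF c] tM by (metis openin_closedin_eq)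
    then show "compactin T (M - D c)"
      by (rule compact_closed)
    have "openin T (P c d \<inter> Q d c)" if "d \<in> B - {c}" for d
      using E[of c d] E[of d c] that c by blast
    then show "openin T (G c)"
      unfolding G_def using B(2) by (blast intro: openin_INT)
    show "D c \<subseteq> G c"
    proof
      fix x assume x: "x \<in> D c"
      have "x \<in> P c d \<inter> Q d c" if "d \<in> B - {c}" for d
      proof -
        have "x \<in> M" "x \<in> E c d" "x \<notin> E d c"
          using x that by (auto simp: D_def)
        then show ?thesis
          using E[of c d] E[of d c] that c by blast
      qed
      moreover have "x \<in> topspace T"
        using x DM MT by blast
      ultimately show "x \<in> G c"
        by (simp add: G_def)
    qed
  next
    show "disjoint_family_on G B"
      unfolding disjoint_family_on_def
    proof (intro ballI impI)
      fix c d assume cd: "c \<in> B" "d \<in> B" "c \<noteq> d"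
      then have "G c \<subseteq> P c d" "G d \<subseteq> Q c d"
        by (auto simp: G_def)
      then show "G c \<inter> G d = {}"
        using E[OF cd] by blast
    qed
  qed
qed

section \<open>Local minima near parts of the set of global minima\<close>

text \<open>The perturbation argument for a single part \<open>D\<close>, which is clopen in the set of global minima
  because both \<open>D\<close> and its complement there are compact.  The open set \<open>G\<close> prescribes where the
  local minimum has to lie, so that different parts give different points.\<close>

lemma local_min_near_clopen_part:
  fixes \<Phi> :: "'a \<Rightarrow> real" and \<Psi> :: "'a \<Rightarrow> ereal" and r :: real
  assumes T: "Hausdorff_space T"
    and ninf: "\<And>x. x \<in> topspace T \<Longrightarrow> \<Psi> x \<noteq> -\<infinity>"
    and r: "ereal r > (INF x \<in> topspace T. \<Psi> x)"
    and sub: "strict_sublevel T \<Psi> r \<subseteq> C"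
    and C: "compactin T C" and fc: "first_countable (subtopology T C)"
    and bdd: "bdd_below (\<Phi> ` C)"
    and lsc: "\<exists>\<delta>>0. \<forall>\<mu>::real. 0 \<le> \<mu> \<and> \<mu> \<le> \<delta> \<longrightarrow> seq_lsc T (\<lambda>x. \<Psi> x + ereal (\<mu> * \<Phi> x))"
    and D: "D \<noteq> {}" "D \<subseteq> global_minima T \<Psi>" "compactin T D" "compactin T (global_minima T \<Psi> - D)"
    and G: "openin T G" "D \<subseteq> G"
  shows "\<exists>\<delta>>0. \<forall>\<mu>::real. 0 < \<mu> \<and> \<mu> < \<delta> \<longrightarrow>
    (\<exists>x \<in> G \<inter> strict_sublevel T \<Psi> r.
       is_local_min (sublevel_topology T \<Psi>) (\<lambda>y. \<Psi> y + ereal (\<mu> * \<Phi> y)) x)"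
proof -
  obtain \<delta>0 where \<delta>0: "\<delta>0 > 0"
    "\<And>\<mu>. 0 \<le> \<mu> \<Longrightarrow> \<mu> \<le> \<delta>0 \<Longrightarrow> seq_lsc T (\<lambda>x. \<Psi> x + ereal (\<mu> * \<Phi> x))"
    using lsc by blast
  have CT: "C \<subseteq> topspace T" and Ccl: "closedin T C"
    using C compactin_subset_topspace compactin_imp_closedin[OF T] by blast+
  have closed_sublevel: "closedin T {x \<in> C. \<Psi> x + ereal (\<mu> * \<Phi> x) \<le> t}"
    if "0 \<le> \<mu>" "\<mu> \<le> \<delta>0" for \<mu> t
    using \<delta>0(2)[OF that] Ccl fc by (rule closedin_sublevel_seq_lsc)
  have closed_sublevel0: "closedin T {x \<in> C. \<Psi> x \<le> t}" for t
    using closed_sublevel[of 0 t] \<delta>0(1) by (simp flip: zero_ereal_def)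
  have closed_sublevel_on: "closedin T {x \<in> A. F x \<le> t}"
    if "A \<subseteq> C" "closedin T A" "closedin T {x \<in> C. F x \<le> t}" for A t and F :: "'a \<Rightarrow> ereal"
  proof -
    have "{x \<in> A. F x \<le> t} = A \<inter> {x \<in> C. F x \<le> t}"
      using that(1) by auto
    then show ?thesis
      using that(2,3) by (metis closedin_Int)
  qed
  obtain z where z: "z \<in> D"
    using D(1) by blast
  then have zT: "z \<in> topspace T" and zmin: "\<Psi> z = (INF y \<in> topspace T. \<Psi> y)"
    using D(2) by (auto simp: global_minima_def)
  obtain m where m: "\<Psi> z = ereal m"
    using ninf[OF zT] r unfolding zmin[symmetric] by (cases "\<Psi> z") auto
  have mr: "m < r"
    using r unfolding zmin[symmetric] m by simp
  have zC: "z \<in> C"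
    using sub zT m mr by (auto simp: strict_sublevel_def)
  obtain V W where VW: "openin T V" "openin T W" "D \<subseteq> V" "global_minima T \<Psi> - D \<subseteq> W"
      "V \<subseteq> G" "V \<inter> W = {}"
  proof -
    obtain V W where "openin T V" "openin T W" "D \<subseteq> V" "global_minima T \<Psi> - D \<subseteq> W" "disjnt V W"
      using Hausdorff_space_compact_separation[OF T D(3,4)] by (metis Diff_disjoint disjnt_def)
    then show ?thesis
      using that[of "V \<inter> G" W] G by (auto simp: disjnt_def)
  qed
  have "\<exists>s. m < s \<and> s < r \<and> {x \<in> C. \<Psi> x \<le> ereal s} \<subseteq> V \<union> W"
  proof -
    let ?K = "C - (V \<union> W)"
    show ?thesis
    proof (cases "?K = {}")
      case True
      obtain s where "m < s" "s < r"
        using dense mr by blast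
      with True show ?thesis
        by blast
    next
      case False
      have Kcl: "closedin T ?K"
        using Ccl VW(1,2) by (blast intro: closedin_diff openin_Un)
      have "compactin T ?K"
        using closed_compactin[OF C _ Kcl] by blast
      moreover have "closedin T {x \<in> ?K. \<Psi> x \<le> t}" for t
        using closed_sublevel_on[OF _ Kcl closed_sublevel0] by blast
      ultimately obtain y where y: "y \<in> ?K" "\<And>u. u \<in> ?K \<Longrightarrow> \<Psi> y \<le> \<Psi> u"
        using compactin_attains_inf_closed_sublevels[OF _ False, of T \<Psi>] by metis
      have "y \<in> topspace T"
        using y(1) CT by blast
      moreover have "y \<notin> global_minima T \<Psi>"
        using y(1) VW(3,4) by blast
      ultimately have "\<Psi> z < \<Psi> y"
        unfolding zmin by (auto simp: global_minima_def less_le intro: INF_lower)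
      then have "ereal m < min (\<Psi> y) (ereal r)"
        using m mr by simp
      then obtain s where s: "ereal m < ereal s" "ereal s < min (\<Psi> y) (ereal r)"
        using ereal_dense2 by blast
      have "{x \<in> C. \<Psi> x \<le> ereal s} \<subseteq> V \<union> W"
        using y(2) s(2) by (fastforce simp: not_le dest: order.strict_trans1)
      then show ?thesis
        using s by auto
    qed
  qed
  then obtain s where s: "m < s" "s < r" and split: "{x \<in> C. \<Psi> x \<le> ereal s} \<subseteq> V \<union> W"
    by blast
  \<comment> \<open>Removing the open set \<open>W\<close> is the same as intersecting with \<open>V\<close>, and leaves a closed set.\<close>
  define A where "A = {x \<in> C. \<Psi> x \<le> ereal s} - W"
  have Acl: "closedin T A"
    unfolding A_def using closed_sublevel0 VW(2) by (rule closedin_diff)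
  have AC: "A \<subseteq> C"
    by (auto simp: A_def)
  have Acpt: "compactin T A"
    using C AC Acl by (rule closed_compactin)
  have AV: "A \<subseteq> V"
    using split by (auto simp: A_def)
  have zA: "z \<in> A"
    using z zC m s VW(3,6) by (auto simp: A_def)
  obtain b where b: "\<And>x. x \<in> C \<Longrightarrow> b \<le> \<Phi> x"
    using bdd unfolding bdd_below_def by blast
  \<comment> \<open>Adding \<open>1\<close> keeps the denominator positive when \<open>z\<close> minimizes \<open>\<Phi>\<close> on \<open>C\<close>.\<close>
  define \<delta> where "\<delta> = min \<delta>0 ((s - m) / (\<Phi> z - b + 1))"
  have pos: "\<Phi> z - b + 1 > 0"
    using b[OF zC] by simp
  have "\<delta> > 0"
    using \<delta>0(1) s pos by (simp add: \<delta>_def)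
  moreover have "\<exists>x \<in> G \<inter> strict_sublevel T \<Psi> r.
      is_local_min (sublevel_topology T \<Psi>) (\<lambda>y. \<Psi> y + ereal (\<mu> * \<Phi> y)) x"
    if \<mu>: "0 < \<mu>" "\<mu> < \<delta>" for \<mu>
  proof -
    let ?F = "\<lambda>y. \<Psi> y + ereal (\<mu> * \<Phi> y)"
    have "A \<noteq> {}"
      using zA by blast
    have "closedin T {x \<in> A. ?F x \<le> t}" for t
      using closed_sublevel_on[OF AC Acl closed_sublevel] \<mu> by (simp add: \<delta>_def)
    then obtain x where x: "x \<in> A" "\<And>y. y \<in> A \<Longrightarrow> ?F x \<le> ?F y"
      using compactin_attains_inf_closed_sublevels[OF Acpt \<open>A \<noteq> {}\<close>, of ?F] by metis
    have xC: "x \<in> C" and xV: "x \<in> V"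
      using x(1) AC AV by auto
    have xs: "\<Psi> x < ereal s"
    proof -
      have "\<mu> * (\<Phi> z - b + 1) < s - m"
        using \<mu>(2) pos by (simp add: \<delta>_def pos_less_divide_eq)
      then have "m + \<mu> * \<Phi> z < s + \<mu> * b"
        using \<mu>(1) by (simp add: algebra_simps)
      moreover have "\<mu> * b \<le> \<mu> * \<Phi> x"
        using b[OF xC] \<mu>(1) by simp
      ultimately have "m + \<mu> * \<Phi> z < s + \<mu> * \<Phi> x"
        by simp
      moreover have "\<Psi> x + ereal (\<mu> * \<Phi> x) \<le> ereal (m + \<mu> * \<Phi> z)"
        using x(2)[OF zA] m by simp
      ultimately show ?thesis
        by (cases "\<Psi> x") auto
    qed
    let ?N = "V \<inter> strict_sublevel T \<Psi> s"
    have NA: "?N \<subseteq> A"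
    proof
      fix y assume y: "y \<in> ?N"
      then have "y \<in> strict_sublevel T \<Psi> r"
        using s(2) order.strict_trans[of "\<Psi> y" "ereal s" "ereal r"]
        by (simp add: strict_sublevel_def)
      then show "y \<in> A"
        using y sub VW(6) by (auto simp: A_def strict_sublevel_def)
    qed
    have "is_local_min (sublevel_topology T \<Psi>) ?F x"
      unfolding is_local_min_def topspace_sublevel_topology
    proof (intro conjI exI)
      show "x \<in> topspace T"
        using xC CT by blast
      show "openin (sublevel_topology T \<Psi>) ?N"
        using VW(1)
        by (intro openin_Int openin_sublevel_topology_base openin_sublevel_topology_sublevel)
      show "x \<in> ?N"
        using xV xs xC CT by (auto simp: strict_sublevel_def)
      show "\<forall>y\<in>?N. ?F x \<le> ?F y"
        using NA x(2) by blast
    qed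
    moreover have "x \<in> G \<inter> strict_sublevel T \<Psi> r"
      using xV VW(5) xC CT order.strict_trans[OF xs, of "ereal r"] s(2)
      by (auto simp: strict_sublevel_def)
    ultimately show ?thesis
      by blast
  qed
  ultimately show ?thesis
    by blast
qed

theorem theorem2:
  fixes T :: "'a topology" and k :: nat
    and \<Phi> :: "'a \<Rightarrow> real" and \<Psi> :: "'a \<Rightarrow> ereal" and r :: real
  assumes "Hausdorff_space T"
    and "k > 0"
    and "\<And>x. x \<in> topspace T \<Longrightarrow> \<Psi> x \<noteq> -\<infinity>"
    and "ereal r > (INF x \<in> topspace T. \<Psi> x)"
    and "compactin T (T closure_of strict_sublevel T \<Psi> r)"
    and "first_countable (subtopology T (T closure_of strict_sublevel T \<Psi> r))"
    and "bdd_below (\<Phi> ` (T closure_of strict_sublevel T \<Psi> r))"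
    and "\<exists>\<delta>>0. \<forall>\<mu>::real. 0 \<le> \<mu> \<and> \<mu> \<le> \<delta> \<longrightarrow> seq_lsc T (\<lambda>x. \<Psi> x + ereal (\<mu> * \<Phi> x))"
    and "has_at_least k (connected_components_of (subtopology T (global_minima T \<Psi>)))"
  shows "\<exists>\<delta>>0. \<forall>\<mu>::real. 0 < \<mu> \<and> \<mu> < \<delta> \<longrightarrow>
           has_at_least k {x \<in> strict_sublevel T \<Psi> r.
             is_local_min (sublevel_topology T \<Psi>) (\<lambda>y. \<Psi> y + ereal (\<mu> * \<Phi> y)) x}"
proof -
  let ?C = "T closure_of strict_sublevel T \<Psi> r" and ?M = "global_minima T \<Psi>"
  let ?L = "\<lambda>\<mu>. {x \<in> strict_sublevel T \<Psi> r.
             is_local_min (sublevel_topology T \<Psi>) (\<lambda>y. \<Psi> y + ereal (\<mu> * \<Phi> y)) x}"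
  have sub: "strict_sublevel T \<Psi> r \<subseteq> ?C"
    by (rule closure_of_subset) (auto simp: strict_sublevel_def)
  have "compactin T ?M"
  proof -
    let ?m = "INF x \<in> topspace T. \<Psi> x"
    have "?M \<subseteq> ?C"
      using sub assms(4) by (auto simp: global_minima_def strict_sublevel_def)
    moreover have "?M = {x \<in> topspace T. \<Psi> x \<le> ?m}"
      unfolding global_minima_def by (auto intro!: antisym intro: INF_lower)
    ultimately have "?M = {x \<in> ?C. \<Psi> x \<le> ?m}"
      using closure_of_subset_topspace[of T "strict_sublevel T \<Psi> r"] by blast
    moreover have "seq_lsc T \<Psi>"
    proof -
      obtain \<delta> :: real where "\<delta> > 0"
        and "\<And>\<mu>. 0 \<le> \<mu> \<and> \<mu> \<le> \<delta> \<Longrightarrow> seq_lsc T (\<lambda>x. \<Psi> x + ereal (\<mu> * \<Phi> x))"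
        using assms(8) by blast
      from this(2)[of 0] this(1) show ?thesis
        by (simp flip: zero_ereal_def)
    qed
    ultimately have "closedin T ?M"
      using closedin_sublevel_seq_lsc[OF _ closedin_closure_of assms(6)] by metis
    then show ?thesis
      using closed_compactin[OF assms(5) \<open>?M \<subseteq> ?C\<close>] by blast
  qed
  moreover obtain B where B: "B \<subseteq> connected_components_of (subtopology T ?M)" "finite B" "card B = k"
    using assms(9) unfolding has_at_least_def by blast
  ultimately obtain D G where
    D: "\<And>c. c \<in> B \<Longrightarrow> D c \<noteq> {}" "\<And>c. c \<in> B \<Longrightarrow> D c \<subseteq> ?M"
      "\<And>c. c \<in> B \<Longrightarrow> compactin T (D c)" "\<And>c. c \<in> B \<Longrightarrow> compactin T (?M - D c)"
    and G: "\<And>c. c \<in> B \<Longrightarrow> openin T (G c)" "\<And>c. c \<in> B \<Longrightarrow> D c \<subseteq> G c"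
    and disj: "disjoint_family_on G B"
    using disjoint_neighbourhoods_of_components[OF assms(1), of ?M B] by blast
  have "\<forall>c\<in>B. \<exists>\<delta>>0. \<forall>\<mu>::real. 0 < \<mu> \<and> \<mu> < \<delta> \<longrightarrow> (\<exists>x. x \<in> G c \<inter> ?L \<mu>)"
  proof
    fix c assume c: "c \<in> B"
    show "\<exists>\<delta>>0. \<forall>\<mu>::real. 0 < \<mu> \<and> \<mu> < \<delta> \<longrightarrow> (\<exists>x. x \<in> G c \<inter> ?L \<mu>)"
      using local_min_near_clopen_part[OF assms(1,3,4) sub assms(5-8) D(1-4)[OF c] G(1,2)[OF c]]
      by blast
  qed
  from bchoice[OF this] obtain \<delta> where \<delta>: "\<And>c. c \<in> B \<Longrightarrow> \<delta> c > 0"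
    and ex: "\<And>c \<mu>. c \<in> B \<Longrightarrow> 0 < \<mu> \<Longrightarrow> \<mu> < \<delta> c \<Longrightarrow> \<exists>x. x \<in> G c \<inter> ?L \<mu>"
    by blast
  define \<delta>' where "\<delta>' = Min (\<delta> ` B)"
  have "B \<noteq> {}"
    using B(3) assms(2) by auto
  then have "\<delta>' > 0"
    using \<delta> B(2) by (simp add: \<delta>'_def)
  moreover have "has_at_least k (?L \<mu>)" if \<mu>: "0 < \<mu>" "\<mu> < \<delta>'" for \<mu>
  proof -
    have "\<mu> < \<delta> c" if "c \<in> B" for c
      using \<mu>(2) B(2) \<open>B \<noteq> {}\<close> that by (simp add: \<delta>'_def)
    then have "\<forall>c\<in>B. \<exists>x. x \<in> G c \<inter> ?L \<mu>"
      using ex[OF _ \<mu>(1)] by blast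
    from bchoice[OF this] obtain x where x: "\<And>c. c \<in> B \<Longrightarrow> x c \<in> G c \<inter> ?L \<mu>"
      by blast
    have "inj_on x B"
    proof (rule inj_onI, rule ccontr)
      fix c d assume cd: "c \<in> B" "d \<in> B" "x c = x d" "c \<noteq> d"
      then have "x c \<in> G c" "x c \<in> G d"
        using x[of c] x[of d] by auto
      with disj cd show False
        unfolding disjoint_family_on_def by blast
    qed
    then have "card (x ` B) = k"
      using B(3) by (simp add: card_image)
    moreover have "x ` B \<subseteq> ?L \<mu>"
      using x by blast
    ultimately show ?thesis
      unfolding has_at_least_def using B(2) by blast
  qed
  ultimately show ?thesis
    by blast
qed

end
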